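(* Let $D:[0,1]^2\to[0,1]$ be a commutative fuzzy disjunction, let $N_D:[0,1]\to[0,1]$, $N_D(x)=\inf\{t\in[0,1]\mid D(x,t)=1\}$, be its natural negation, and suppose that $N_D$ is a fuzzy negation. Then the following statements are equivalent: (i) $N_D$ is strictly decreasing. (ii) $N_D$ is continuous. (iii) $N_D$ is strict. (iv) $N_D$ is strong.
   Context: A fuzzy disjunction is a function $D:[0,1]^2\to[0,1]$ that is non-decreasing in each variable and satisfies $D(0,0)=0$ and $D(1,1)=D(1,0)=D(0,1)=1$. It is commutative if $D(x,y)=D(y,x)$ for all $x,y\in[0,1]$. A fuzzy negation is a non-increasing function $N:[0,1]\to[0,1]$ with $N(0)=1$ and $N(1)=0$. A fuzzy negation $N$ is strict if it is strictly decreasing and continuous; it is strong if $N(N(x))=x$ for all $x\in[0,1]$. *)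

theory Defs
  imports Complex_Main
begin

text \<open>
  Operations on the unit interval are modelled as functions on all reals; only their values
  at arguments in \<open>{0..1}\<close> matter in the definitions below.
\<close>

definition fuzzy_disjunction :: "(real \<Rightarrow> real \<Rightarrow> real) \<Rightarrow> bool" where
  "fuzzy_disjunction D \<longleftrightarrow>
     (\<forall>x\<in>{0..1}. \<forall>y\<in>{0..1}. D x y \<in> {0..1}) \<and>
     (\<forall>y\<in>{0..1}. mono_on {0..1} (\<lambda>x. D x y)) \<and>
     (\<forall>x\<in>{0..1}. mono_on {0..1} (D x)) \<and>
     D 0 0 = 0 \<and> D 1 1 = 1 \<and> D 1 0 = 1 \<and> D 0 1 = 1"

definition fuzzy_commutative :: "(real \<Rightarrow> real \<Rightarrow> real) \<Rightarrow> bool" where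
  "fuzzy_commutative D \<longleftrightarrow> (\<forall>x\<in>{0..1}. \<forall>y\<in>{0..1}. D x y = D y x)"

definition fuzzy_negation :: "(real \<Rightarrow> real) \<Rightarrow> bool" where
  "fuzzy_negation N \<longleftrightarrow>
     (\<forall>x\<in>{0..1}. N x \<in> {0..1}) \<and> antimono_on {0..1} N \<and> N 0 = 1 \<and> N 1 = 0"

definition strict_fuzzy_negation :: "(real \<Rightarrow> real) \<Rightarrow> bool" where
  "strict_fuzzy_negation N \<longleftrightarrow>
     fuzzy_negation N \<and> strict_antimono_on {0..1} N \<and> continuous_on {0..1} N"

definition strong_fuzzy_negation :: "(real \<Rightarrow> real) \<Rightarrow> bool" where
  "strong_fuzzy_negation N \<longleftrightarrow> fuzzy_negation N \<and> (\<forall>x\<in>{0..1}. N (N x) = x)"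

text \<open>
  For a fuzzy disjunction \<open>D\<close> and \<open>x\<close> in \<open>{0..1}\<close> the set below contains \<open>1\<close>
  (as \<open>D x 1 \<ge> D 0 1 = 1\<close>) and is bounded below by \<open>0\<close>, so \<open>Inf\<close> is a genuine infimum.
\<close>

definition natural_negation :: "(real \<Rightarrow> real \<Rightarrow> real) \<Rightarrow> real \<Rightarrow> real" where
  "natural_negation D x = Inf {t \<in> {0..1}. D x t = 1}"

end

theory Submission
  imports Defs
begin

text \<open>
  Write \<open>N\<close> for the natural negation of \<open>D\<close>. Since \<open>N x < t\<close> forces \<open>D x t = 1\<close>, and
  \<open>D x t = D t x\<close>, commutativity yields the symmetry \<open>N x < t \<Longrightarrow> N t \<le> x\<close>
  (lemma \<open>natural_negation_swap\<close>), equivalently \<open>x < N t \<Longrightarrow> t \<le> N x\<close>. Beyond this, only the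
  fact that \<open>N\<close> is a fuzzy negation is needed: \<open>N\<close> is almost its own generalised inverse, the generalised inverse of a decreasing function
  turns plateaus into jumps, and so \<open>N\<close> has a plateau if and only if it has a jump.

  In detail, if \<open>N\<close> is strictly decreasing, a point strictly between \<open>x\<close> and \<open>N (N x)\<close> would
  contradict the symmetry, so \<open>N\<close> is an involution. An antitone involution is injective, hence
  strictly decreasing, and it is continuous because \<open>a < N y\<close> is then equivalent to \<open>y < N a\<close>,
  an open condition on \<open>y\<close>, and dually. Finally, if \<open>N\<close> is
  constant on \<open>{a..b}\<close> with value \<open>c\<close>, then by the symmetry \<open>N\<close> takes no value strictly between
  \<open>a\<close> and \<open>b\<close> except possibly at \<open>c\<close>, which contradicts the intermediate value theorem if
  \<open>N\<close> is continuous.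
\<close>

lemma natural_negation_swap:
  assumes D: "fuzzy_disjunction D" "fuzzy_commutative D"
    and x: "x \<in> {0..1}" and t: "t \<in> {0..1}"
    and less: "natural_negation D x < t"
  shows "natural_negation D t \<le> x"
proof -
  have range: "D r s \<le> 1" if "r \<in> {0..1}" "s \<in> {0..1}" for r s
    using D that unfolding fuzzy_disjunction_def by auto
  have "mono_on {0..1} (\<lambda>r. D r 1)" "mono_on {0..1} (D x)"
    using D x unfolding fuzzy_disjunction_def by auto
  note mono = this[THEN mono_onD]
  have "D 0 1 \<le> D x 1" "D x 1 \<le> 1"
    using mono(1)[of 0 x] range[of x 1] x by auto
  then have "D x 1 = 1"
    using D unfolding fuzzy_disjunction_def by simp
  then have "{s \<in> {0..1}. D x s = 1} \<noteq> {}"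
    by force
  then obtain s where s: "s \<in> {0..1}" "D x s = 1" "s < t"
    using cInf_lessD[of "{s \<in> {0..1}. D x s = 1}" t] less
    unfolding natural_negation_def by auto
  have "D x s \<le> D x t" "D x t \<le> 1"
    using mono(2)[of s t] range[of x t] x t s by auto
  then have "D t x = 1"
    using s D x t unfolding fuzzy_commutative_def by auto
  then show ?thesis
    unfolding natural_negation_def using x by (intro cInf_lower) (auto intro: bdd_belowI[of _ 0])
qed

lemma strict_imp_involution:
  fixes N :: "real \<Rightarrow> real"
  assumes swap: "\<And>x t. x \<in> {0..1} \<Longrightarrow> t \<in> {0..1} \<Longrightarrow> N x < t \<Longrightarrow> N t \<le> x"
    and range: "\<And>x. x \<in> {0..1} \<Longrightarrow> N x \<in> {0..1}"
    and strict: "strict_antimono_on {0..1} N"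
    and x: "x \<in> {0..1}"
  shows "N (N x) = x"
proof (rule ccontr)
  assume "N (N x) \<noteq> x"
  then consider "N (N x) < x" | "x < N (N x)"
    by linarith
  then show False
  proof cases
    case 1
    then obtain y where y: "N (N x) < y" "y < x"
      using dense by blast
    have y01: "y \<in> {0..1}"
      using y x range[OF range[OF x]] by auto
    have "N y \<le> N x"
      using swap[OF range[OF x] y01] y by simp
    moreover have "N x < N y"
      using strict y x y01 by (auto simp: monotone_on_def)
    ultimately show False by simp
  next
    case 2
    then obtain y where y: "x < y" "y < N (N x)"
      using dense by blast
    have y01: "y \<in> {0..1}"
      using y x range[OF range[OF x]] by auto
    have "N x \<le> N y"
      using swap[OF y01 range[OF x]] y by force
    moreover have "N y < N x"
      using strict y x y01 by (auto simp: monotone_on_def)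
    ultimately show False by simp
  qed
qed

lemma continuous_imp_strict:
  fixes N :: "real \<Rightarrow> real"
  assumes swap: "\<And>x t. x \<in> {0..1} \<Longrightarrow> t \<in> {0..1} \<Longrightarrow> N x < t \<Longrightarrow> N t \<le> x"
    and neg: "fuzzy_negation N"
    and cont: "continuous_on {0..1} N"
  shows "strict_antimono_on {0..1} N"
proof (rule monotone_onI)
  fix a b :: real
  assume a: "a \<in> {0..1}" and b: "b \<in> {0..1}" and ab: "a < b"
  have "N b \<le> N a"
    using neg a b ab by (auto simp: fuzzy_negation_def monotone_on_def)
  moreover have "N a \<noteq> N b"
  proof
    assume eq: "N a = N b"
    have only: "N (N a) = m" if m: "a < m" "m < b" for m
    proof -
      have "\<exists>s\<ge>0. s \<le> 1 \<and> N s = m"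
        using neg m a b cont by (intro IVT2') (auto simp: fuzzy_negation_def)
      then obtain s where s: "s \<in> {0..1}" "N s = m"
        by auto
      have "\<not> N a < s"
        using swap[OF a s(1)] s m by auto
      moreover have "\<not> s < N b"
        using swap[OF s(1) b] s m by auto
      ultimately have "s = N a"
        using eq by simp
      then show ?thesis using s by simp
    qed
    obtain m where m: "a < m" "m < b" using dense ab by blast
    obtain m' where m': "m < m'" "m' < b" using dense m by blast
    show False
      using only[of m] only[of m'] m m' by simp
  qed
  ultimately show "N b < N a" by simp
qed

lemma involution_imp_strict:
  fixes N :: "real \<Rightarrow> real"
  assumes "strong_fuzzy_negation N"
  shows "strict_antimono_on {0..1} N"
proof (rule monotone_onI)
  fix a b :: real
  assume ab: "a \<in> {0..1}" "b \<in> {0..1}" "a < b"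
  then have "N b \<le> N a"
    using assms by (auto simp: strong_fuzzy_negation_def fuzzy_negation_def monotone_on_def)
  moreover have "N (N a) \<noteq> N (N b)"
    using assms ab by (simp add: strong_fuzzy_negation_def)
  ultimately show "N b < N a"
    by (cases "N b = N a") auto
qed

lemma involution_imp_continuous:
  fixes N :: "real \<Rightarrow> real"
  assumes strong: "strong_fuzzy_negation N"
  shows "continuous_on {0..1} N"
  unfolding continuous_on_def
proof (intro ballI order_tendstoI)
  have range: "N y \<in> {0..1}" and inv: "N (N y) = y" if "y \<in> {0..1}" for y
    using strong that by (auto simp: strong_fuzzy_negation_def fuzzy_negation_def)
  have strict: "N z < N y" if "y \<in> {0..1}" "z \<in> {0..1}" "y < z" for y z
    using involution_imp_strict[OF strong] that by (auto simp: monotone_on_def)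
  fix x a :: real
  assume x: "x \<in> {0..1}"
  {
    assume a: "a < N x"
    show "\<forall>\<^sub>F y in at x within {0..1}. a < N y"
    proof (cases "a < 0")
      case True
      show ?thesis
        unfolding eventually_at_filter using range True
          by (intro always_eventually) (auto intro: less_le_trans order_le_less_trans)
    next
      case False
      then have a01: "a \<in> {0..1}" using a range[OF x] by auto
      \<comment> \<open>For \<open>y < N a\<close>, applying \<open>N\<close> gives \<open>a = N (N a) < N y\<close>.\<close>
      have "x < N a"
        using strict[OF a01 range[OF x] a] inv[OF x] by simp
      then have "\<forall>\<^sub>F y in at x within {0..1}. y < N a"
        by (rule order_tendstoD[OF tendsto_ident_at])
      moreover have "\<forall>\<^sub>F y in at x within {0..1}. y \<in> {0..1}"
        by (simp add: eventually_at_filter)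
      ultimately show ?thesis
      proof eventually_elim
        case (elim y)
        then show ?case using strict[OF elim(2) range[OF a01]] inv[OF a01] by simp
      qed
    qed
  next
    assume a: "N x < a"
    show "\<forall>\<^sub>F y in at x within {0..1}. N y < a"
    proof (cases "1 < a")
      case True
      show ?thesis
        unfolding eventually_at_filter using range True
          by (intro always_eventually) (auto intro: less_le_trans order_le_less_trans)
    next
      case False
      then have a01: "a \<in> {0..1}" using a range[OF x] by auto
      have "N a < x"
        using strict[OF range[OF x] a01 a] inv[OF x] by simp
      then have "\<forall>\<^sub>F y in at x within {0..1}. N a < y"
        by (rule order_tendstoD[OF tendsto_ident_at])
      moreover have "\<forall>\<^sub>F y in at x within {0..1}. y \<in> {0..1}"
        by (simp add: eventually_at_filter)
      ultimately show ?thesis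
      proof eventually_elim
        case (elim y)
        then show ?case using strict[OF range[OF a01] elim(2)] inv[OF a01] by simp
      qed
    qed
  }
qed

theorem theorem3p2:
  fixes D :: "real \<Rightarrow> real \<Rightarrow> real"
  assumes "fuzzy_disjunction D"
    and "fuzzy_commutative D"
    and "fuzzy_negation (natural_negation D)"
  shows "(strict_antimono_on {0..1} (natural_negation D) \<longleftrightarrow>
            continuous_on {0..1} (natural_negation D)) \<and>
         (continuous_on {0..1} (natural_negation D) \<longleftrightarrow>
            strict_fuzzy_negation (natural_negation D)) \<and>
         (strict_fuzzy_negation (natural_negation D) \<longleftrightarrow>
            strong_fuzzy_negation (natural_negation D))"
proof -
  let ?N = "natural_negation D"
  note swap = natural_negation_swap[OF assms(1,2)]
  have "?N x \<in> {0..1}" if "x \<in> {0..1}" for x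
    using assms(3) that by (auto simp: fuzzy_negation_def)
  then have strong: "strong_fuzzy_negation ?N" if "strict_antimono_on {0..1} ?N"
    using strict_imp_involution[OF swap _ that] assms(3) by (simp add: strong_fuzzy_negation_def)
  have strict: "strict_antimono_on {0..1} ?N" if "continuous_on {0..1} ?N"
    using continuous_imp_strict[OF swap assms(3) that] by simp
  show ?thesis
    using strong strict involution_imp_strict[of ?N] involution_imp_continuous[of ?N] assms(3)
    unfolding strict_fuzzy_negation_def by argo
qed

end
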